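(* The directed coverage measure $I_{DC}$ is standout consistent.
   Context: For $x,y\in\mathbb{R}^d$, $y$ dominates $x$ if $x_i\le y_i$ for all $i\in[d]$ and $x_j<y_j$ for some $j\in[d]$. A set of alternatives is a finite set $A\subseteq\mathbb{R}^d$ ($d\ge 1$ arbitrary) none of whose elements is dominated by another element of $A$. Let $\|x-y\|_+=\sum_{i=1}^d\max(x_i-y_i,0)$. For nonempty $S\subseteq A$, $I_{DC}(S,A)=\max_{a\in A}\min_{s\in S}\|a-s\|_+$ (lower is better). For a positive integer $k$, $\mathcal{S}(I_{DC},A,k)$ is the set of all $S\subseteq A$ with $|S|=k$ minimizing $I_{DC}(S,A)$ among the size-$k$ subsets of $A$. An alternative $x\in A$ is a standout alternative if $\min_{a\in A\setminus\{x\}}\|x-a\|_+>\max_{a\in A\setminus\{x\}}\|a-x\|_+$. A measure $I$ is standout consistent if for any set of alternatives $A$ containing a standout alternative $x\in A$, we have $x\in S$ for each $k\ge 1$ and each $S\in\mathcal{S}(I,A,k)$. *)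

theory Defs
  imports "HOL-Analysis.Finite_Cartesian_Product"
begin

definition dominates :: "real ^ 'd::finite \<Rightarrow> real ^ 'd \<Rightarrow> bool" where
  "dominates y x \<longleftrightarrow> (\<forall>i. x $ i \<le> y $ i) \<and> (\<exists>j. x $ j < y $ j)"

definition alternatives :: "(real ^ 'd::finite) set \<Rightarrow> bool" where
  "alternatives A \<longleftrightarrow> finite A \<and> (\<forall>x\<in>A. \<forall>y\<in>A. \<not> dominates y x)"

definition plus_norm :: "real ^ 'd::finite \<Rightarrow> real" where
  "plus_norm z = (\<Sum>i\<in>UNIV. max (z $ i) 0)"

text \<open>A measure takes the selected subset first and the full set of alternatives second,
  as in \<open>I(S, A)\<close>; lower values are better.\<close>

type_synonym 'd measure_fn = "(real ^ 'd) set \<Rightarrow> (real ^ 'd) set \<Rightarrow> real"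

definition directed_coverage :: "'d::finite measure_fn" where
  "directed_coverage S A = Max ((\<lambda>a. Min ((\<lambda>s. plus_norm (a - s)) ` S)) ` A)"

definition optimal_subsets :: "'d::finite measure_fn \<Rightarrow> (real ^ 'd) set \<Rightarrow> nat \<Rightarrow> (real ^ 'd) set set" where
  "optimal_subsets I A k = {S. is_arg_min (\<lambda>T. I T A) (\<lambda>T. T \<subseteq> A \<and> card T = k) S}"

text \<open>\<^const>\<open>Min\<close> and \<^const>\<open>Max\<close> are unspecified on the empty set. If \<open>x\<close> is the only
  alternative, it counts as a standout, following the usual convention that the minimum over the
  empty set is \<open>\<infinity>\<close> and the maximum is \<open>-\<infinity>\<close>.\<close>

definition standout :: "(real ^ 'd::finite) set \<Rightarrow> real ^ 'd \<Rightarrow> bool" where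
  "standout A x \<longleftrightarrow> x \<in> A \<and>
     (A - {x} \<noteq> {} \<longrightarrow>
        Min ((\<lambda>a. plus_norm (x - a)) ` (A - {x})) > Max ((\<lambda>a. plus_norm (a - x)) ` (A - {x})))"

definition standout_consistent :: "'d::finite measure_fn \<Rightarrow> bool" where
  "standout_consistent I \<longleftrightarrow>
     (\<forall>A x. alternatives A \<longrightarrow> standout A x \<longrightarrow>
        (\<forall>k\<ge>1. \<forall>S\<in>optimal_subsets I A k. x \<in> S))"

end

theory Submission imports Defs begin

text \<open>If an optimal \<open>S\<close> missed the standout alternative \<open>x\<close>, exchanging any element of \<open>S\<close>
  for \<open>x\<close> would strictly improve the measure: before the exchange the point \<open>x\<close> itself is covered
  only at distance at least \<open>min \<parallel>x - a\<parallel>\<^sub>+\<close>, afterwards every point is covered from \<open>x\<close> at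
  distance at most \<open>max \<parallel>a - x\<parallel>\<^sub>+\<close>.\<close>

lemma plus_norm_nonneg: "0 \<le> plus_norm z"
  unfolding plus_norm_def by (rule sum_nonneg) simp

lemma plus_norm_0 [simp]: "plus_norm 0 = 0"
  by (simp add: plus_norm_def)

lemma directed_coverage_less_iff:
  assumes "finite A" "A \<noteq> {}" "finite S" "S \<noteq> {}"
  shows "directed_coverage S A < c \<longleftrightarrow> (\<forall>a\<in>A. \<exists>s\<in>S. plus_norm (a - s) < c)"
  using assms by (simp add: directed_coverage_def Min_less_iff)

text \<open>This replaces the extrema by single points. \<open>a\<close> and \<open>b\<close> may
  coincide, which the exchange argument exploits.\<close>

lemma standout_gap:
  assumes "finite A" "standout A x" "a \<in> A - {x}" "b \<in> A - {x}"
  shows "plus_norm (a - x) < plus_norm (x - b)"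
proof -
  have "plus_norm (a - x) \<le> Max ((\<lambda>a. plus_norm (a - x)) ` (A - {x}))"
    using assms by (intro Max_ge) auto
  also have "\<dots> < Min ((\<lambda>a. plus_norm (x - a)) ` (A - {x}))"
    using assms unfolding standout_def by blast
  also have "\<dots> \<le> plus_norm (x - b)"
    using assms by (intro Min_le) auto
  finally show ?thesis .
qed

lemma directed_coverage_exchange:
  assumes A: "finite A" and x: "standout A x"
    and S: "S \<subseteq> A" "S \<noteq> {}" "x \<notin> S" and T: "finite T" "x \<in> T"
  shows "directed_coverage T A < directed_coverage S A"
proof -
  have "x \<in> A" using x by (simp add: standout_def)
  have "finite S" using A S finite_subset by blast
  \<comment> \<open>Since \<open>x\<close> is itself a point to be covered, its nearest
    \<open>b\<close> in \<open>S\<close> gives a lower bound for the coverage of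
    \<open>S\<close>.\<close>
  have "Min ((\<lambda>s. plus_norm (x - s)) ` S) \<le> directed_coverage S A"
    unfolding directed_coverage_def using A \<open>x \<in> A\<close> by (intro Max_ge) auto
  moreover have "Min ((\<lambda>s. plus_norm (x - s)) ` S) \<in> (\<lambda>s. plus_norm (x - s)) ` S"
    using \<open>finite S\<close> S by (intro Min_in) auto
  ultimately obtain b where b: "b \<in> S" "plus_norm (x - b) \<le> directed_coverage S A"
    by auto
  have b': "b \<in> A - {x}" using b S by auto
  have "plus_norm (a - x) < plus_norm (x - b)" if "a \<in> A" for a
  proof (cases "a = x")
    \<comment> \<open>Here the left side is 0. The gap with \<open>b\<close> in both places gives
      \<open>plus_norm (x - b) > plus_norm (b - x)\<close>, and the latter is at least 0.\<close>
    case True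
    then show ?thesis
      using standout_gap[OF A x b' b'] plus_norm_nonneg[of "b - x"] by simp
  next
    case False
    then show ?thesis using standout_gap[OF A x _ b'] that by simp
  qed
  then have "directed_coverage T A < plus_norm (x - b)"
    using directed_coverage_less_iff[OF A _ T(1)] T \<open>x \<in> A\<close> by blast
  with b show ?thesis by simp
qed

theorem proposition19:
  shows "standout_consistent (directed_coverage :: 'd::finite measure_fn)"
  unfolding standout_consistent_def
proof (intro allI impI ballI, rule ccontr)
  fix A S :: "(real ^ 'd) set" and x k
  assume "alternatives A" and x: "standout A x" and k: "1 \<le> k"
    and opt: "S \<in> optimal_subsets directed_coverage A k" and "x \<notin> S"
  then have A: "finite A" by (simp add: alternatives_def)
  have S: "S \<subseteq> A" "card S = k"
    and best: "\<And>T. T \<subseteq> A \<Longrightarrow> card T = k \<Longrightarrow> \<not> directed_coverage T A < directed_coverage S A"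
    using opt by (auto simp: optimal_subsets_def is_arg_min_def)
  have "finite S" using S A finite_subset by blast
  \<comment> \<open>\<open>k \<ge> 1\<close> makes \<open>S\<close> nonempty, so there is an element
    to trade for \<open>x\<close> at equal cardinality.\<close>
  obtain s where s: "s \<in> S" using S k by fastforce
  define T where "T = insert x (S - {s})"
  have "T \<subseteq> A" using S x by (auto simp: T_def standout_def)
  moreover have "card T = k"
    using \<open>finite S\<close> \<open>x \<notin> S\<close> s S k by (simp add: T_def)
  moreover have "directed_coverage T A < directed_coverage S A"
    using \<open>finite S\<close> S s \<open>x \<notin> S\<close> by (intro directed_coverage_exchange[OF A x]) (auto simp: T_def)
  ultimately show False using best by blast
qed

end
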